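(* Let $\eta$ be a non-periodic Toeplitz sequence with period structure $(p_n)_{n\ge1}$, and let $\tilde\tau_n$ be the minimal period of the set $\widetilde{\mathcal H}_n$ of essential holes at level $n$. (a) If an automorphism $F$ of $(X_\eta,\sigma)$ satisfies $\partial W+y_F\subseteq\partial W+\Delta(k)$ for some $k=k_F\in\mathbb Z$, then $\tilde\tau_n\mid (y_F)_n-k_F$ for all $n\in\mathbb N$. In particular, if infinitely many $\widetilde{\mathcal H}_n$ have minimal period $p_n$, then the centralizer of $(X_\eta,\sigma)$ is trivial. (b) Suppose that for each automorphism $F\in\operatorname{Aut}_\sigma(X_\eta)$ there exists a unique $k_F\in\mathbb Z$ such that $\partial W+y_F\subseteq\partial W+\Delta(k_F)$. If $M:=\liminf_{n\to\infty}p_n/\tilde\tau_n<\infty$, then $$\operatorname{Aut}_\sigma(X_\eta)=\langle\sigma\rangle\oplus\operatorname{Tor},$$ where $\operatorname{Tor}$ denotes the torsion group of $\operatorname{Aut}_\sigma(X_\eta)$. Moreover, $\operatorname{Tor}$ is a cyclic group (possibly trivial), whose order divides $M$.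
   Context: $\mathbb N=\{1,2,\dots\}$. A non-periodic Toeplitz sequence with period structure $p_1\mid p_2\mid p_3\mid\dots\to\infty$ is a non-periodic $\eta\in\{0,1\}^{\mathbb Z}$ such that for each $k\in\mathbb Z$ there is $n\ge1$ with $\eta|_{k+p_n\mathbb Z}$ constant. $\sigma$ is the left shift and $X_\eta$ the orbit closure of $\eta$ under $\sigma$ in $\{0,1\}^{\mathbb Z}$. For $i=0,1$: $\mathcal P_n^i=\{k\in\mathbb Z:\eta|_{k+p_n\mathbb Z}=i\}$; $\mathcal H_n=\mathbb Z\setminus(\mathcal P_n^0\cup\mathcal P_n^1)$ is the set of holes at level $n$; the set of essential holes at level $N$ is $\widetilde{\mathcal H}_N=\{k\in\mathcal H_N:\mathcal H_n\cap(k+p_N\mathbb Z)\neq\emptyset\ \text{for all } n\ge N\}$. It is $p_N$-periodic, so its minimal period $\tilde\tau_N$ divides $p_N$. $G=\varprojlim\mathbb Z/p_n\mathbb Z$; $\Delta:\mathbb Z\to G$, $\Delta(k)=(k+p_n\mathbb Z)_n$; $T g=g+\Delta(1)$; $U_n(h)=\{g\in G:g_n=h_n\}$. $V^i=\bigcup_{n}\bigcup_{k\in\mathcal P_n^i\cap[0,p_n)}U_n(\Delta(k))$, the window is $W=\overline{V^1}=G\setminus V^0$, and its topological boundary is $\partial W=G\setminus(V^0\cup V^1)$. $(G,T)$ is the maximal equicontinuous factor of $(X_\eta,\sigma)$, with factor map $\pi:X_\eta\to G$ determined by $\pi(\eta)=\Delta(0)$. $\operatorname{Aut}_\sigma(X_\eta)$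 (the automorphism group, or centralizer) is the group of homeomorphisms of $X_\eta$ commuting with $\sigma$; it is called trivial if it consists only of powers of $\sigma$. For each automorphism $F$ there is a unique $y_F\in G$ with $\pi(F(x))=\pi(x)+y_F$ for all $x\in X_\eta$. The torsion group is the subgroup of elements of finite order. Convention: an integer $t$ divides $z\in\mathbb Z/p_n\mathbb Z$ if $z\in t\cdot(\mathbb Z/p_n\mathbb Z)$; integers $k$ are identified with their classes when combined with elements of $\mathbb Z/p_n\mathbb Z$.
   Formalization: In the "in particular" of (a), the formal theorem also assumes that every automorphism F satisfies ∂W+y_F ⊆ ∂W+Δ(k) for some integer k; without this the claim fails, and the condition holds automatically whenever the centralizer is trivial. *)

theory Defs
  imports
    "HOL-Analysis.Analysis"
    "HOL-Algebra.Elementary_Groups"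
    "HOL-Algebra.Product_Groups"
    "HOL-Algebra.Bij"
    "HOL-Number_Theory.Cong"
    "HOL-Library.Extended_Nat"
begin

text \<open>
  Conventions. The alphabet is \<^typ>\<open>bool\<close> (\<^term>\<open>True\<close> for 1, \<^term>\<open>False\<close> for 0), and
  \<^typ>\<open>int \<Rightarrow> bool\<close> carries the product topology of its type class instance. Levels are
  indexed by \<^typ>\<open>nat\<close> starting at 0, so the first period $p_1$ is \<open>p 0\<close>. Elements of
  $\mathbf{Z}/m$ are represented by their residues in \<open>{0..<m}\<close>.
\<close>

section \<open>Toeplitz sequences and their holes\<close>

definition periodic :: "(int \<Rightarrow> bool) \<Rightarrow> bool" where
  "periodic \<eta> \<longleftrightarrow> (\<exists>t::nat. 0 < t \<and> (\<forall>k. \<eta> (k + int t) = \<eta> k))"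

definition period_structure :: "(nat \<Rightarrow> nat) \<Rightarrow> bool" where
  "period_structure p \<longleftrightarrow>
     (\<forall>n. 0 < p n) \<and> (\<forall>n. p n dvd p (Suc n)) \<and> filterlim p at_top sequentially"

definition nonperiodic_toeplitz :: "(int \<Rightarrow> bool) \<Rightarrow> (nat \<Rightarrow> nat) \<Rightarrow> bool" where
  "nonperiodic_toeplitz \<eta> p \<longleftrightarrow>
     period_structure p \<and> \<not> periodic \<eta> \<and>
     (\<forall>k. \<exists>n. \<forall>m. \<eta> (k + int (p n) * m) = \<eta> k)"

definition const_positions :: "(int \<Rightarrow> bool) \<Rightarrow> (nat \<Rightarrow> nat) \<Rightarrow> nat \<Rightarrow> bool \<Rightarrow> int set" where
  "const_positions \<eta> p n i = {k. \<forall>m. \<eta> (k + int (p n) * m) = i}"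

definition holes :: "(int \<Rightarrow> bool) \<Rightarrow> (nat \<Rightarrow> nat) \<Rightarrow> nat \<Rightarrow> int set" where
  "holes \<eta> p n = UNIV - (const_positions \<eta> p n False \<union> const_positions \<eta> p n True)"

definition essential_holes :: "(int \<Rightarrow> bool) \<Rightarrow> (nat \<Rightarrow> nat) \<Rightarrow> nat \<Rightarrow> int set" where
  "essential_holes \<eta> p N =
     {k \<in> holes \<eta> p N. \<forall>n\<ge>N. holes \<eta> p n \<inter> range (\<lambda>m. k + int (p N) * m) \<noteq> {}}"

definition minimal_period :: "int set \<Rightarrow> nat" where
  "minimal_period A = (LEAST t. 0 < t \<and> (\<forall>k. k + int t \<in> A \<longleftrightarrow> k \<in> A))"

definition hole_period :: "(int \<Rightarrow> bool) \<Rightarrow> (nat \<Rightarrow> nat) \<Rightarrow> nat \<Rightarrow> nat" where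
  "hole_period \<eta> p n = minimal_period (essential_holes \<eta> p n)"


section \<open>The subshift and its automorphism group\<close>

definition shift_by :: "int \<Rightarrow> (int \<Rightarrow> bool) \<Rightarrow> int \<Rightarrow> bool" where
  "shift_by k x = (\<lambda>i. x (i + k))"

abbreviation shift :: "(int \<Rightarrow> bool) \<Rightarrow> int \<Rightarrow> bool" where
  "shift \<equiv> shift_by 1"

definition orbit_closure :: "(int \<Rightarrow> bool) \<Rightarrow> (int \<Rightarrow> bool) set" where
  "orbit_closure \<eta> = closure (range (\<lambda>k. shift_by k \<eta>))"

text \<open>
  As in \<^const>\<open>BijGroup\<close>, the group elements are self-maps of the subshift that are
  \<^const>\<open>undefined\<close> outside of it, multiplied by composition.
\<close>

definition Aut :: "(int \<Rightarrow> bool) \<Rightarrow> ((int \<Rightarrow> bool) \<Rightarrow> int \<Rightarrow> bool) monoid" where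
  "Aut \<eta> = (BijGroup (orbit_closure \<eta>))
     \<lparr>carrier := {F \<in> extensional (orbit_closure \<eta>).
        (\<exists>F'. homeomorphism (orbit_closure \<eta>) (orbit_closure \<eta>) F F') \<and>
        (\<forall>x\<in>orbit_closure \<eta>. F (shift x) = shift (F x))}\<rparr>"

definition shift_aut :: "(int \<Rightarrow> bool) \<Rightarrow> (int \<Rightarrow> bool) \<Rightarrow> int \<Rightarrow> bool" where
  "shift_aut \<eta> = restrict shift (orbit_closure \<eta>)"


section \<open>The odometer, the window and its boundary\<close>

definition odometer :: "(nat \<Rightarrow> nat) \<Rightarrow> (nat \<Rightarrow> int) monoid" where
  "odometer p = (product_group UNIV (\<lambda>n. integer_mod_group (p n)))
     \<lparr>carrier := {g. (\<forall>n. g n \<in> carrier (integer_mod_group (p n))) \<and>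
                     (\<forall>n. g (Suc n) mod int (p n) = g n)}\<rparr>"

text \<open>
  The topology of the inverse limit is that of a subspace of the product of the discrete
  spaces \<^typ>\<open>int\<close>. Closure and boundary have to be taken relative to this subspace, since
  the odometer has empty interior in \<^typ>\<open>nat \<Rightarrow> int\<close>.
\<close>

definition odometer_topology :: "(nat \<Rightarrow> nat) \<Rightarrow> (nat \<Rightarrow> int) topology" where
  "odometer_topology p = top_of_set (carrier (odometer p))"

definition int_embed :: "(nat \<Rightarrow> nat) \<Rightarrow> int \<Rightarrow> nat \<Rightarrow> int" where
  "int_embed p k = (\<lambda>n. k mod int (p n))"

definition cylinder :: "(nat \<Rightarrow> nat) \<Rightarrow> nat \<Rightarrow> (nat \<Rightarrow> int) \<Rightarrow> (nat \<Rightarrow> int) set" where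
  "cylinder p n h = {g \<in> carrier (odometer p). g n = h n}"

definition const_region :: "(int \<Rightarrow> bool) \<Rightarrow> (nat \<Rightarrow> nat) \<Rightarrow> bool \<Rightarrow> (nat \<Rightarrow> int) set" where
  "const_region \<eta> p i =
     (\<Union>n. \<Union>k \<in> const_positions \<eta> p n i \<inter> {0..<int (p n)}. cylinder p n (int_embed p k))"

definition window :: "(int \<Rightarrow> bool) \<Rightarrow> (nat \<Rightarrow> nat) \<Rightarrow> (nat \<Rightarrow> int) set" where
  "window \<eta> p = odometer_topology p closure_of const_region \<eta> p True"

definition window_boundary :: "(int \<Rightarrow> bool) \<Rightarrow> (nat \<Rightarrow> nat) \<Rightarrow> (nat \<Rightarrow> int) set" where
  "window_boundary \<eta> p = odometer_topology p frontier_of window \<eta> p"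


section \<open>The factor map onto the odometer\<close>

text \<open>
  A period structure as defined above need not consist of essential periods, so the
  existence of the factor map \<open>\<pi>\<close> is a genuine condition on \<open>\<eta>\<close> and \<open>p\<close>. Maximality of the
  equicontinuous factor does not have to be required: the Toeplitz property makes the fibre
  of \<open>\<pi>\<close> over 0 a singleton, so points with the same image under \<open>\<pi>\<close> are proximal and hence
  identified in every equicontinuous factor.
\<close>

definition odometer_factor_map ::
    "(int \<Rightarrow> bool) \<Rightarrow> (nat \<Rightarrow> nat) \<Rightarrow> ((int \<Rightarrow> bool) \<Rightarrow> nat \<Rightarrow> int) \<Rightarrow> bool" where
  "odometer_factor_map \<eta> p \<pi> \<longleftrightarrow>
     continuous_on (orbit_closure \<eta>) \<pi> \<and>
     \<pi> ` orbit_closure \<eta> = carrier (odometer p) \<and>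
     (\<forall>x\<in>orbit_closure \<eta>. \<pi> (shift x) = \<pi> x \<otimes>\<^bsub>odometer p\<^esub> int_embed p 1) \<and>
     \<pi> \<eta> = int_embed p 0"

definition translation ::
    "(int \<Rightarrow> bool) \<Rightarrow> (nat \<Rightarrow> nat) \<Rightarrow> ((int \<Rightarrow> bool) \<Rightarrow> nat \<Rightarrow> int) \<Rightarrow>
     ((int \<Rightarrow> bool) \<Rightarrow> int \<Rightarrow> bool) \<Rightarrow> nat \<Rightarrow> int" where
  "translation \<eta> p \<pi> F =
     (THE y. y \<in> carrier (odometer p) \<and>
        (\<forall>x\<in>orbit_closure \<eta>. \<pi> (F x) = \<pi> x \<otimes>\<^bsub>odometer p\<^esub> y))"

text \<open>With \<open>y\<close> the translation of \<open>F\<close>: $\partial W + y \subseteq \partial W + \Delta(k)$.\<close>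

definition boundary_shift ::
    "(int \<Rightarrow> bool) \<Rightarrow> (nat \<Rightarrow> nat) \<Rightarrow> ((int \<Rightarrow> bool) \<Rightarrow> nat \<Rightarrow> int) \<Rightarrow>
     ((int \<Rightarrow> bool) \<Rightarrow> int \<Rightarrow> bool) \<Rightarrow> int \<Rightarrow> bool" where
  "boundary_shift \<eta> p \<pi> F k \<longleftrightarrow>
     window_boundary \<eta> p #>\<^bsub>odometer p\<^esub> translation \<eta> p \<pi> F
       \<subseteq> window_boundary \<eta> p #>\<^bsub>odometer p\<^esub> int_embed p k"


section \<open>Arithmetic and group theory\<close>

text \<open>The class of \<open>z\<close> modulo \<open>m\<close> lies in $t \cdot (\mathbf{Z}/m)$.\<close>

definition dvd_mod :: "nat \<Rightarrow> nat \<Rightarrow> int \<Rightarrow> bool" where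
  "dvd_mod m t z \<longleftrightarrow> (\<exists>w. [z = int t * w] (mod int m))"

definition torsion :: "('a, 'b) monoid_scheme \<Rightarrow> 'a set" where
  "torsion G = {x \<in> carrier G. \<exists>n::nat. 0 < n \<and> x [^]\<^bsub>G\<^esub> n = \<one>\<^bsub>G\<^esub>}"

definition internal_direct_sum :: "('a, 'b) monoid_scheme \<Rightarrow> 'a set \<Rightarrow> 'a set \<Rightarrow> bool" where
  "internal_direct_sum G A B \<longleftrightarrow>
     subgroup A G \<and> subgroup B G \<and>
     (\<lambda>(a, b). a \<otimes>\<^bsub>G\<^esub> b) \<in> iso (G\<lparr>carrier := A\<rparr> \<times>\<times> G\<lparr>carrier := B\<rparr>) G"

end

theory Submission
  imports Defs
begin

text \<open>
  The boundary of the window consists of the $g$ all of whose coordinates $g_n$ are holes, so by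
  compactness its projection to $\mathbf{Z}/p_n$ is the set of essential holes at level $n$. If
  $\partial W + y \subseteq \partial W + \Delta(k)$, then $y_n - k$ maps this set into itself and hence is
  a multiple of its minimal period. An automorphism is determined by its translation, because
  the fibre of \<open>\<pi>\<close> over 0 is a singleton; so the coordinates $(y_F)_n$ are homomorphisms to
  $\mathbf{Z}/p_n$ that jointly separate automorphisms. When $k_F$ is unique, $F \mapsto k_F$ is a
  homomorphism to the integers, split by the shift. On its kernel, $(y_F)_n$ lies in a subgroup of
  order $p_n / \tilde\tau_n$, which equals $M$ for infinitely many $n$; so the kernel is killed
  by $M$, is the torsion group, and embeds in a cyclic group of order $M$.
\<close>

section \<open>Periods, lower limits and cyclic groups\<close>

text \<open>An inclusion is all that is asked of \<open>d\<close>, because the boundary hypothesis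
  is an inclusion and not an equality. The remainder of \<open>d\<close> modulo the minimal period
  again maps \<open>A\<close> into itself, and if positive it would be a smaller period.\<close>

lemma minimal_period_dvd:
  assumes "0 < P" and per: "\<And>k. k + int P \<in> A \<longleftrightarrow> k \<in> A"
    and d: "\<And>k. k \<in> A \<Longrightarrow> k + d \<in> A"
  shows "int (minimal_period A) dvd d"
proof -
  define t where "t = minimal_period A"
  have t: "0 < t \<and> (\<forall>k. k + int t \<in> A \<longleftrightarrow> k \<in> A)"
    unfolding t_def minimal_period_def by (rule LeastI[of _ P]) (use assms in auto)
  have tz: "k + int t * j \<in> A \<longleftrightarrow> k \<in> A" for k j
  proof (induction j arbitrary: k rule: int_induct[where k = 0])
    case (step1 i)
    then show ?case
      using t by (metis add.assoc add.commute distrib_left mult.right_neutral)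
  next
    case (step2 i)
    have "k + int t * (i - 1) + int t = k + int t * i"
      by (simp add: algebra_simps)
    then show ?case
      using t step2 by metis
  qed auto
  have pz: "k + int P * int j \<in> A \<longleftrightarrow> k \<in> A" for k j
  proof (induction j arbitrary: k)
    case (Suc j)
    have "k + int P * int (Suc j) = (k + int P * int j) + int P"
      by (simp add: algebra_simps)
    then show ?case
      using per Suc by metis
  qed auto
  define r where "r = d mod int t"
  have "r \<ge> 0" "r < int t"
    using t by (auto simp: r_def)
  have up: "k + r \<in> A" if "k \<in> A" for k
  proof -
    have "k + d = (k + r) + int t * (d div int t)"
      by (simp add: r_def algebra_simps)
    then show ?thesis
      using d[OF that] tz by metis
  qed
  have ups: "k + r * int j \<in> A" if "k \<in> A" for k j
  proof (induction j)
    case (Suc j)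
    have "k + r * int (Suc j) = (k + r * int j) + r"
      by (simp add: algebra_simps)
    then show ?case
      using up[OF Suc] by metis
  qed (use that in auto)
  \<comment> \<open>The one-sided period \<open>r\<close> is two-sided because \<open>P * r\<close> is a multiple of a two-sided one.\<close>
  have "k \<in> A" if "k + r \<in> A" for k
  proof -
    have "k + r + r * int (P - 1) = k + int P * int (nat r)"
      using \<open>0 < P\<close> \<open>r \<ge> 0\<close> by (simp add: algebra_simps of_nat_diff)
    then show ?thesis
      using ups[OF that, of "P - 1"] pz by metis
  qed
  then have "\<forall>k. k + int (nat r) \<in> A \<longleftrightarrow> k \<in> A"
    using up \<open>r \<ge> 0\<close> by auto
  moreover have "\<not> (0 < nat r \<and> (\<forall>k. k + int (nat r) \<in> A \<longleftrightarrow> k \<in> A))"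
    by (rule not_less_Least[where P = "\<lambda>s. 0 < s \<and> (\<forall>k. k + int s \<in> A \<longleftrightarrow> k \<in> A)"])
       (use \<open>r \<ge> 0\<close> \<open>r < int t\<close> in \<open>simp add: t_def minimal_period_def nat_less_iff\<close>)
  ultimately have "r = 0"
    using \<open>r \<ge> 0\<close> by auto
  then show "int (minimal_period A) dvd d"
    by (auto simp: r_def t_def)
qed

text \<open>The values are integers, so eventually they are at least \<open>M\<close>. If
  \<open>M\<close> were taken only finitely often, they would eventually be at least
  \<open>Suc M\<close>, and so would the lower limit.\<close>

lemma liminf_enat_eq_imp_infinite:
  fixes f :: "nat \<Rightarrow> nat"
  assumes lim: "liminf (\<lambda>n. enat (f n)) = enat M"
  shows "infinite {n. f n = M}"
proof
  assume "finite {n. f n = M}"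
  then have "\<forall>\<^sub>F n in cofinite. f n \<noteq> M"
    by (simp add: eventually_cofinite)
  then have ne: "\<forall>\<^sub>F n in sequentially. f n \<noteq> M"
    by (simp add: cofinite_eq_sequentially)
  have ge: "\<forall>\<^sub>F n in sequentially. M \<le> f n"
  proof (cases M)
    case (Suc k)
    then have "enat k < liminf (\<lambda>n. enat (f n))"
      using lim by simp
    then show ?thesis
      by (auto dest!: less_LiminfD elim!: eventually_mono simp: Suc)
  qed auto
  have "\<forall>\<^sub>F n in sequentially. enat (Suc M) \<le> enat (f n)"
    using ne ge by eventually_elim auto
  then have "enat (Suc M) \<le> liminf (\<lambda>n. enat (f n))"
    by (rule Liminf_bounded)
  then show False
    using lim by simp
qed

section \<open>Subgroups of finite cyclic groups\<close>

lemma cyclic_subgroup_integer_mod_group: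
  assumes "0 < M" and H: "subgroup H (integer_mod_group M)"
  shows "cyclic_group ((integer_mod_group M)\<lparr>carrier := H\<rparr>)"
proof -
  let ?Z = "integer_mod_group M"
  interpret Z: group ?Z by simp
  interpret H: subgroup H ?Z by (fact H)
  interpret HG: group "?Z\<lparr>carrier := H\<rparr>"
    by (rule Z.subgroup_imp_group[OF H])
  \<comment> \<open>The generator is the class of the least positive representative of an element of
    \<open>H\<close>; division with remainder by \<open>d\<close> shows that it generates. The
    number \<open>M\<close>, representing 0, guarantees existence and is the value of
    \<open>d\<close> for the trivial subgroup.\<close>
  define d where "d = (LEAST d. 0 < d \<and> int d mod int M \<in> H)"
  have "0 < d \<and> int d mod int M \<in> H"
    unfolding d_def by (rule LeastI[of _ M]) (use \<open>0 < M\<close> H.one_closed in auto)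
  then have d: "0 < d" "int d mod int M \<in> H"
    by auto
  have pow: "(int d mod int M) [^]\<^bsub>?Z\<^esub> (j::int) = int d * j mod int M" for j
    by (simp add: int_pow_integer_mod_group mult.commute mod_mult_right_eq)
  have "x \<in> range (\<lambda>j::int. (int d mod int M) [^]\<^bsub>?Z\<^esub> j)" if x: "x \<in> H" for x
  proof -
    have xb: "0 \<le> x" "x < int M"
      using H.mem_carrier[OF x] \<open>0 < M\<close> by (auto simp: carrier_integer_mod_group)
    have "x \<otimes>\<^bsub>?Z\<^esub> ((int d mod int M) [^]\<^bsub>?Z\<^esub> (- (x div int d))) \<in> H"
      using x d(2) H by (metis H.m_closed Z.subgroup_int_pow_closed)
    also have "x \<otimes>\<^bsub>?Z\<^esub> ((int d mod int M) [^]\<^bsub>?Z\<^esub> (- (x div int d)))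
        = (x mod int d) mod int M"
      by (simp only: pow mult_integer_mod_group mod_add_right_eq)
         (simp add: minus_mult_div_eq_mod)
    finally have "int (nat (x mod int d)) mod int M \<in> H"
      using d by simp
    moreover have "nat (x mod int d) < d"
      using d by (simp add: nat_less_iff)
    then have "\<not> (0 < nat (x mod int d) \<and> int (nat (x mod int d)) mod int M \<in> H)"
      unfolding d_def by (rule not_less_Least)
    ultimately have "nat (x mod int d) = 0"
      by (metis gr0I)
    then have "x mod int d = 0"
      using pos_mod_sign[of "int d" x] d(1) by linarith
    then have "x = int d * (x div int d) mod int M"
      using xb by auto
    then show ?thesis
      using pow by (metis rangeI)
  qed
  moreover have "(int d mod int M) [^]\<^bsub>?Z\<^esub> (j::int) \<in> H" for j
    by (rule Z.subgroup_int_pow_closed[OF H d(2)])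
  ultimately have "H = range (\<lambda>j::int. (int d mod int M) [^]\<^bsub>?Z\<lparr>carrier := H\<rparr>\<^esub> j)"
    using Z.int_pow_consistent[OF H d(2)] by (metis (no_types, lifting) image_cong image_subsetI subsetI subset_antisym)
  then show ?thesis
    unfolding HG.cyclic_group using d(2) by auto
qed

lemma cyclic_group_of_mono_integer_mod_group:
  assumes K: "group K" and "0 < M"
    and h: "h \<in> hom K (integer_mod_group M)" and inj: "inj_on h (carrier K)"
  shows "cyclic_group K" and "finite (carrier K)" and "order K dvd M"
proof -
  let ?Z = "integer_mod_group M"
  interpret group_hom K ?Z h
    using K h by (simp add: group_hom_def group_hom_axioms_def)
  have S: "subgroup (h ` carrier K) ?Z"
    by (rule img_is_subgroup)
  have "h \<in> iso K (?Z\<lparr>carrier := h ` carrier K\<rparr>)"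
    using h inj by (auto simp: iso_def hom_def bij_betw_def)
  then have "K \<cong> ?Z\<lparr>carrier := h ` carrier K\<rparr>"
    by (rule is_isoI)
  then show "cyclic_group K"
    using cyclic_subgroup_integer_mod_group[OF \<open>0 < M\<close> S] isomorphic_group_cyclicity K
      H.subgroup_imp_group[OF S] by blast
  have fin: "finite (carrier ?Z)" and M: "order ?Z = M"
    using \<open>0 < M\<close> by (auto simp: carrier_integer_mod_group order_def)
  show "finite (carrier K)"
    using finite_imageD[OF finite_subset[OF _ fin] inj] subgroup.subset[OF S] by blast
  have "card (h ` carrier K) dvd order ?Z"
    using H.lagrange[OF S] by (metis dvd_triv_right)
  then show "order K dvd M"
    using M by (simp add: order_def card_image[OF inj])
qed

section \<open>Groups separated by homomorphisms to finite cyclic groups\<close>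

text \<open>The model is the automorphism group with \<open>T n F\<close> the n-th coordinate of the
  translation of \<open>F\<close>. Compatibility between levels is retained only as the fact that
  the kernels of the \<open>T n\<close> decrease.\<close>

locale residue_homs = group A for A (structure) +
  fixes p :: "nat \<Rightarrow> nat" and T :: "nat \<Rightarrow> 'a \<Rightarrow> int"
  assumes p_pos: "0 < p n"
    and T_hom: "T n \<in> hom A (integer_mod_group (p n))"
    and T_zero_Suc: "x \<in> carrier A \<Longrightarrow> T (Suc n) x = 0 \<Longrightarrow> T n x = 0"
    and T_separating: "x \<in> carrier A \<Longrightarrow> (\<And>n. T n x = 0) \<Longrightarrow> x = \<one>"
begin

lemma T_group_hom: "group_hom A (integer_mod_group (p n)) (T n)"
  using T_hom by (simp add: group_hom_def group_hom_axioms_def is_group)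

lemma T_zero_mono: "x \<in> carrier A \<Longrightarrow> T n x = 0 \<Longrightarrow> m \<le> n \<Longrightarrow> T m x = 0"
proof (induction n)
  case (Suc n)
  then show ?case
    using T_zero_Suc[OF Suc.prems(1,2)] by (metis le_Suc_eq)
qed auto

lemma T_mult: "x \<in> carrier A \<Longrightarrow> y \<in> carrier A \<Longrightarrow> T n (x \<otimes> y) = (T n x + T n y) mod int (p n)"
  using T_hom[of n] by (auto simp: hom_def)

lemma T_bounds: "x \<in> carrier A \<Longrightarrow> 0 \<le> T n x \<and> T n x < int (p n)"
  using T_hom[of n] p_pos[of n] by (auto simp: hom_def carrier_integer_mod_group Pi_def)

lemma T_pow: "x \<in> carrier A \<Longrightarrow> T n (x [^] (j::nat)) = int j * T n x mod int (p n)"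
  using group_hom.hom_nat_pow[OF T_group_hom] by simp

lemma T_int_pow: "x \<in> carrier A \<Longrightarrow> T n (x [^] (j::int)) = j * T n x mod int (p n)"
  using group_hom.hom_int_pow[OF T_group_hom] by (simp add: int_pow_integer_mod_group)

text \<open>Since the kernels decrease, agreement at one level gives agreement at all lower levels.
  Infinitely many levels therefore suffice, which is all that a lower limit provides.\<close>

lemma eq_if_frequently_T_eq:
  assumes x: "x \<in> carrier A" and y: "y \<in> carrier A" and N: "infinite {n. T n x = T n y}"
  shows "x = y"
proof -
  have "T n (x \<otimes> inv y) = 0" for n
  proof -
    obtain m where m: "n \<le> m" "T m x = T m y"
      using N by (auto simp: infinite_nat_iff_unbounded_le)
    have "T m (x \<otimes> inv y) = T m (y \<otimes> inv y)"
      using x y m(2) by (simp only: T_mult inv_closed)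
    also have "\<dots> = 0"
      using group_hom.hom_one[OF T_group_hom[of m]] y by simp
    finally show ?thesis
      using T_zero_mono[OF _ _ m(1)] x y by simp
  qed
  then have "x \<otimes> inv y = \<one>"
    using x y by (intro T_separating) auto
  then show ?thesis
    using x y by (metis inv_closed inv_equality inv_inv)
qed

lemma T_eqI: "x \<in> carrier A \<Longrightarrow> y \<in> carrier A \<Longrightarrow> (\<And>n. T n x = T n y) \<Longrightarrow> x = y"
  by (rule eq_if_frequently_T_eq) auto

text \<open>The groups of residues are abelian and the \<open>T n\<close> jointly separate
  elements.\<close>

lemma commute: "x \<in> carrier A \<Longrightarrow> y \<in> carrier A \<Longrightarrow> x \<otimes> y = y \<otimes> x"
  by (rule T_eqI) (auto simp: T_mult add.commute)

text \<open>Each pair of distinct elements agrees at only finitely many levels, and a finite set has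
  finitely many pairs.\<close>

lemma eventually_T_inj_on:
  assumes "finite S" "S \<subseteq> carrier A"
  shows "\<forall>\<^sub>F n in sequentially. inj_on (T n) S"
proof -
  have "\<forall>\<^sub>F n in sequentially. T n x = T n y \<longrightarrow> x = y" if "x \<in> S" "y \<in> S" for x y
  proof (cases "x = y")
    case False
    then have "finite {n. T n x = T n y}"
      using eq_if_frequently_T_eq[of x y] that assms by auto
    then have "\<forall>\<^sub>F n in cofinite. T n x \<noteq> T n y"
      by (simp add: eventually_cofinite)
    then show ?thesis
      unfolding cofinite_eq_sequentially by (rule eventually_mono) simp
  qed auto
  then show ?thesis
    unfolding inj_on_def using \<open>finite S\<close> by (auto intro!: eventually_ball_finite)
qed

text \<open>In the application \<open>\<kappa>\<close> sends \<open>F\<close> to its integer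
  \<open>k_F\<close>, \<open>s\<close> is the shift, \<open>\<tau>\<close> gives the hole periods,
  and \<open>M\<close> is the lower limit of the quotients. The condition
  \<open>\<kappa> s = 1\<close> makes the powers of \<open>s\<close> a section of
  \<open>\<kappa>\<close>.\<close>

context
  fixes \<kappa> :: "'a \<Rightarrow> int" and s :: 'a and \<tau> :: "nat \<Rightarrow> nat" and M :: nat
  assumes \<kappa>_hom: "\<kappa> \<in> hom A integer_group"
    and s: "s \<in> carrier A" "\<kappa> s = 1"
    and \<tau>_dvd: "x \<in> carrier A \<Longrightarrow> \<kappa> x = 0 \<Longrightarrow> int (\<tau> n) dvd T n x"
    and inf: "infinite {n. p n = M * \<tau> n}"
begin

interpretation \<kappa>: group_hom A integer_group \<kappa>
  using \<kappa>_hom by (simp add: group_hom_def group_hom_axioms_def is_group)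

lemma M_pos: "0 < M"
proof -
  obtain n where "p n = M * \<tau> n"
    using not_finite_existsD[OF inf] by auto
  then show ?thesis
    using p_pos[of n] by (auto intro: gr0I)
qed

text \<open>Torsion is killed by \<open>\<kappa>\<close> because the integers are torsion-free.
  Conversely, for \<open>x\<close> in the kernel, \<open>\<tau> n\<close> divides
  \<open>T n x\<close>, so \<open>x [^] M\<close> has residue 0 at the infinitely many levels with
  \<open>p n = M * \<tau> n\<close>, and is therefore trivial.\<close>

lemma torsion_eq_kernel: "torsion A = kernel A integer_group \<kappa>"
proof (intro equalityI subsetI)
  fix x assume "x \<in> torsion A"
  then obtain n :: nat where x: "x \<in> carrier A" and n: "0 < n" "x [^] n = \<one>"
    by (auto simp: torsion_def)
  have "int n * \<kappa> x = 0"
    using \<kappa>.hom_nat_pow[OF x, of n] \<kappa>.hom_one n by simp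
  then show "x \<in> kernel A integer_group \<kappa>"
    using x n by (simp add: kernel_def)
next
  fix x assume "x \<in> kernel A integer_group \<kappa>"
  then have x: "x \<in> carrier A" "\<kappa> x = 0"
    by (auto simp: kernel_def)
  have "T n (x [^] M) = T n \<one>" if pn: "p n = M * \<tau> n" for n
  proof -
    have "int (p n) dvd int M * T n x"
      using \<tau>_dvd[OF x, of n] by (simp add: pn mult_dvd_mono)
    then show ?thesis
      using x T_pow[OF x(1), of n M] group_hom.hom_one[OF T_group_hom[of n]] by simp
  qed
  then have "infinite {n. T n (x [^] M) = T n \<one>}"
    using inf by (elim infinite_super[rotated]) auto
  then have "x [^] M = \<one>"
    using x by (intro eq_if_frequently_T_eq) auto
  then show "x \<in> torsion A"
    using x M_pos by (auto simp: torsion_def)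
qed

lemma torsion_subgroup: "subgroup (torsion A) A"
  by (simp add: torsion_eq_kernel \<kappa>.subgroup_kernel)

text \<open>The map \<open>\<kappa>\<close> reads off the exponent of \<open>s\<close>, which gives
  injectivity; dividing \<open>x\<close> by \<open>s [^] \<kappa> x\<close> leaves an element of the
  kernel, which gives surjectivity. Commutativity makes the product map a homomorphism.\<close>

lemma internal_direct_sum_torsion: "internal_direct_sum A (generate A {s}) (torsion A)"
proof -
  have gen: "generate A {s} = range (\<lambda>k::int. s [^] k)"
    using generate_pow[OF s(1)] by auto
  have gs: "subgroup (generate A {s}) A"
    using s by (intro generate_is_subgroup) auto
  have \<kappa>_s: "\<kappa> (s [^] (k::int)) = k" for k
    using \<kappa>.hom_int_pow[OF s(1)] s by simp
  have sk: "s [^] (k::int) \<in> carrier A" for k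
    using s by simp
  have tor: "x \<in> carrier A \<and> \<kappa> x = 0 \<longleftrightarrow> x \<in> torsion A" for x
    by (simp add: torsion_eq_kernel kernel_def)
  let ?m = "\<lambda>(a, b). a \<otimes> b"
  have hom: "?m \<in> hom (A\<lparr>carrier := generate A {s}\<rparr> \<times>\<times> A\<lparr>carrier := torsion A\<rparr>) A"
  proof (rule homI; clarsimp)
    fix a b
    assume "a \<in> generate A {s}" "b \<in> torsion A"
    then have ab: "a \<in> carrier A" "b \<in> carrier A"
      using gs torsion_subgroup by (auto dest: subgroup.mem_carrier)
    then show "a \<otimes> b \<in> carrier A"
      by simp
    fix c d
    assume "c \<in> generate A {s}" "d \<in> torsion A"
    then have cd: "c \<in> carrier A" "d \<in> carrier A"
      using gs torsion_subgroup by (auto dest: subgroup.mem_carrier)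
    show "a \<otimes> c \<otimes> (b \<otimes> d) = a \<otimes> b \<otimes> (c \<otimes> d)"
      using ab cd commute[of b c] by (metis m_assoc m_closed)
  qed
  have inj: "inj_on ?m (generate A {s} \<times> torsion A)"
  proof (rule inj_onI; clarsimp simp: gen)
    fix i j :: int and x y
    assume x: "x \<in> torsion A" and y: "y \<in> torsion A" and eq: "s [^] i \<otimes> x = s [^] j \<otimes> y"
    from x y have xy: "x \<in> carrier A" "y \<in> carrier A" "\<kappa> x = 0" "\<kappa> y = 0"
      by (auto simp flip: tor)
    have "i = \<kappa> (s [^] i \<otimes> x)" "j = \<kappa> (s [^] j \<otimes> y)"
      using xy sk by (simp_all add: \<kappa>.hom_mult \<kappa>_s)
    then have "i = j"
      using eq by simp
    then show "s [^] i = s [^] j \<and> x = y"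
      using eq xy sk by simp
  qed
  have "x \<in> ?m ` (generate A {s} \<times> torsion A)" if x: "x \<in> carrier A" for x
  proof
    show "x = ?m (s [^] \<kappa> x, inv (s [^] \<kappa> x) \<otimes> x)"
      using x sk by (simp flip: m_assoc)
    have "\<kappa> (inv (s [^] \<kappa> x) \<otimes> x) = 0"
      using x sk \<kappa>_s by (simp add: \<kappa>.hom_mult)
    then show "(s [^] \<kappa> x, inv (s [^] \<kappa> x) \<otimes> x) \<in> generate A {s} \<times> torsion A"
      using x sk gen by (simp flip: tor)
  qed
  then have "?m ` (generate A {s} \<times> torsion A) = carrier A"
    using hom by (auto simp: hom_def Pi_def)
  then show ?thesis
    unfolding internal_direct_sum_def iso_def
    using hom inj gs torsion_subgroup by (simp add: bij_betw_def)
qed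

text \<open>Where \<open>p n = M * \<tau> n\<close>, dividing residues by \<open>\<tau> n\<close>
  maps torsion homomorphically to the integers modulo \<open>M\<close>. Injectivity at a single
  level is available only on finite sets, so the argument runs twice: first on finite subsets,
  bounding their size by \<open>M\<close>, then on the whole torsion group, by then known to be
  finite.\<close>

lemma torsion_cyclic:
  "cyclic_group (A\<lparr>carrier := torsion A\<rparr>)" "finite (torsion A)"
  "order (A\<lparr>carrier := torsion A\<rparr>) dvd M"
proof -
  let ?K = "A\<lparr>carrier := torsion A\<rparr>"
  have Kin: "x \<in> carrier A \<and> \<kappa> x = 0" if "x \<in> torsion A" for x
    using that by (simp add: torsion_eq_kernel kernel_def)
  have quot: "(\<lambda>x. T n x div int (\<tau> n)) \<in> hom ?K (integer_mod_group M)
      \<and> (S \<subseteq> torsion A \<and> inj_on (T n) S \<longrightarrow> inj_on (\<lambda>x. T n x div int (\<tau> n)) S)"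
    if pn: "p n = M * \<tau> n" for n S
  proof -
    have \<tau>: "0 < \<tau> n"
      using pn p_pos[of n] by (auto intro: gr0I)
    have fac: "\<exists>a. T n x = int (\<tau> n) * a" if "x \<in> torsion A" for x
      using Kin[OF that] \<tau>_dvd[of x n] by (auto elim: dvdE)
    have "(\<lambda>x. T n x div int (\<tau> n)) \<in> hom ?K (integer_mod_group M)"
    proof (rule homI)
      fix x assume "x \<in> carrier ?K"
      then have x: "x \<in> torsion A" by simp
      obtain a where a: "T n x = int (\<tau> n) * a"
        using fac[OF x] by auto
      have "0 \<le> int (\<tau> n) * a" "int (\<tau> n) * a < int (\<tau> n) * int M"
        using T_bounds[of x n] Kin[OF x] by (auto simp: a pn mult.commute)
      then have "0 \<le> a" "a < int M"
        using \<tau> by (auto simp: zero_le_mult_iff)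
      then show "T n x div int (\<tau> n) \<in> carrier (integer_mod_group M)"
        using \<tau> M_pos by (simp add: a carrier_integer_mod_group)
      fix y assume "y \<in> carrier ?K"
      then have y: "y \<in> torsion A" by simp
      obtain b where b: "T n y = int (\<tau> n) * b"
        using fac[OF y] by auto
      \<comment> \<open>Reducing a multiple of \<open>\<tau> n\<close> modulo
        \<open>\<tau> n * M\<close> amounts to reducing its cofactor modulo
        \<open>M\<close>.\<close>
      have "T n (x \<otimes> y) = (int (\<tau> n) * (a + b)) mod (int (\<tau> n) * int M)"
        using Kin[OF x] Kin[OF y] by (simp add: T_mult a b pn algebra_simps)
      also have "\<dots> = int (\<tau> n) * ((a + b) mod int M)"
        by (simp only: mult_mod_right)
      finally show "T n (x \<otimes>\<^bsub>?K\<^esub> y) div int (\<tau> n)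
          = (T n x div int (\<tau> n)) \<otimes>\<^bsub>integer_mod_group M\<^esub> (T n y div int (\<tau> n))"
        using \<tau> by (simp add: a b del: mult_mod_right)
    qed
    moreover have "inj_on (\<lambda>x. T n x div int (\<tau> n)) S" if S: "S \<subseteq> torsion A" "inj_on (T n) S"
    proof (rule inj_onI)
      fix x y assume xy: "x \<in> S" "y \<in> S" "T n x div int (\<tau> n) = T n y div int (\<tau> n)"
      obtain a b where "T n x = int (\<tau> n) * a" "T n y = int (\<tau> n) * b"
        using fac xy S by blast
      then have "T n x = T n y"
        using xy \<tau> by simp
      then show "x = y"
        using S xy by (auto dest: inj_onD)
    qed
    ultimately show ?thesis
      by blast
  qed
  have level: "\<exists>n. p n = M * \<tau> n \<and> inj_on (T n) S" if S: "finite S" "S \<subseteq> torsion A" for S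
  proof -
    have "S \<subseteq> carrier A"
      using S Kin by auto
    from eventually_T_inj_on[OF S(1) this] obtain m where "\<And>n. n \<ge> m \<Longrightarrow> inj_on (T n) S"
      by (auto simp: eventually_sequentially)
    moreover obtain n where "n \<ge> m" "p n = M * \<tau> n"
      using inf by (auto simp: infinite_nat_iff_unbounded_le)
    ultimately show ?thesis
      by blast
  qed
  have "card S \<le> M" if S: "S \<subseteq> torsion A" "finite S" for S
  proof -
    obtain n where n: "p n = M * \<tau> n" "inj_on (T n) S"
      using level[OF S(2,1)] by auto
    have "(\<lambda>x. T n x div int (\<tau> n)) ` S \<subseteq> {0..<int M}"
      using quot[OF n(1)] S M_pos by (auto simp: hom_def Pi_def carrier_integer_mod_group)
    then have "card ((\<lambda>x. T n x div int (\<tau> n)) ` S) \<le> card {0..<int M}"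
      by (intro card_mono) auto
    moreover have "card ((\<lambda>x. T n x div int (\<tau> n)) ` S) = card S"
      using quot[OF n(1), of S] n S by (simp add: card_image)
    ultimately show ?thesis
      by simp
  qed
  then have fin: "finite (torsion A)"
    using finite_if_finite_subsets_card_bdd by blast
  obtain n where n: "p n = M * \<tau> n" "inj_on (T n) (torsion A)"
    using level[OF fin] by auto
  have K: "group ?K"
    by (rule subgroup_imp_group[OF torsion_subgroup])
  have h: "(\<lambda>x. T n x div int (\<tau> n)) \<in> hom ?K (integer_mod_group M)"
    and inj: "inj_on (\<lambda>x. T n x div int (\<tau> n)) (carrier ?K)"
    using quot[OF n(1), of "torsion A"] n(2) by auto
  show "cyclic_group ?K" "finite (torsion A)" "order ?K dvd M"
    using cyclic_group_of_mono_integer_mod_group[OF K M_pos h inj] by auto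
qed

end

end

section \<open>The automorphism group of the orbit closure\<close>

lemma shift_by_apply: "shift_by k x i = x (i + k)"
  by (simp add: shift_by_def)

lemma shift_by_0 [simp]: "shift_by 0 x = x"
  by (simp add: shift_by_def)

lemma shift_by_shift_by [simp]: "shift_by k (shift_by l x) = shift_by (k + l) x"
  by (simp add: shift_by_def add.assoc)

lemma continuous_on_shift_by: "continuous_on S (shift_by k)"
proof -
  have "continuous_on UNIV (shift_by k)"
    unfolding shift_by_def by (rule continuous_on_coordinatewise_then_product) (rule continuous_on_product_coordinates)
  then show ?thesis
    by (rule continuous_on_subset) simp
qed

lemma orbit_in_orbit_closure: "shift_by k \<eta> \<in> orbit_closure \<eta>"
  unfolding orbit_closure_def by (rule subsetD[OF closure_subset]) (rule rangeI)

lemma self_in_orbit_closure [simp]: "\<eta> \<in> orbit_closure \<eta>"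
  using orbit_in_orbit_closure[of 0] by simp

lemma shift_by_in_orbit_closure:
  assumes "x \<in> orbit_closure \<eta>"
  shows "shift_by k x \<in> orbit_closure \<eta>"
proof -
  have "shift_by k ` orbit_closure \<eta> \<subseteq> orbit_closure \<eta>"
    unfolding orbit_closure_def
    by (rule image_closure_subset[OF continuous_on_shift_by])
      (use orbit_in_orbit_closure in \<open>auto simp: orbit_closure_def\<close>)
  then show ?thesis
    using assms by blast
qed

text \<open>Continuous maps to discrete spaces are locally constant, so a point of the dense orbit
  near \<open>x\<close> matches both values at once. This carries identities from the orbit of
  \<open>\<eta>\<close> to its closure.\<close>

lemma orbit_closure_approx:
  fixes f :: "(int \<Rightarrow> bool) \<Rightarrow> 'a::discrete_topology" and g :: "(int \<Rightarrow> bool) \<Rightarrow> 'b::discrete_topology"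
  assumes f: "continuous_on (orbit_closure \<eta>) f" and g: "continuous_on (orbit_closure \<eta>) g"
    and x: "x \<in> orbit_closure \<eta>"
  obtains k where "f (shift_by k \<eta>) = f x" "g (shift_by k \<eta>) = g x"
proof -
  have "openin (top_of_set (orbit_closure \<eta>)) (orbit_closure \<eta> \<inter> f -` {f x})"
    "openin (top_of_set (orbit_closure \<eta>)) (orbit_closure \<eta> \<inter> g -` {g x})"
    using continuous_openin_preimage_gen[OF f] continuous_openin_preimage_gen[OF g] by (auto simp: open_discrete)
  then obtain U V where U: "open U" "orbit_closure \<eta> \<inter> f -` {f x} = orbit_closure \<eta> \<inter> U"
    and V: "open V" "orbit_closure \<eta> \<inter> g -` {g x} = orbit_closure \<eta> \<inter> V"
    by (auto simp: openin_open)
  have "x \<in> U \<inter> V"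
    using U V x by blast
  moreover have "open (U \<inter> V)"
    using U V by auto
  ultimately obtain k where "shift_by k \<eta> \<in> U \<inter> V"
    using x unfolding orbit_closure_def closure_iff_nhds_not_empty by blast
  then have "f (shift_by k \<eta>) = f x" "g (shift_by k \<eta>) = g x"
    using U(2) V(2) orbit_in_orbit_closure[of k \<eta>] by blast+
  then show thesis
    by (rule that)
qed

lemma Aut_carrierD:
  assumes "F \<in> carrier (Aut \<eta>)"
  shows Aut_extensional: "F \<in> extensional (orbit_closure \<eta>)"
    and Aut_Bij: "F \<in> Bij (orbit_closure \<eta>)"
    and Aut_continuous: "continuous_on (orbit_closure \<eta>) F"
    and Aut_in: "x \<in> orbit_closure \<eta> \<Longrightarrow> F x \<in> orbit_closure \<eta>"
    and Aut_shift: "x \<in> orbit_closure \<eta> \<Longrightarrow> F (shift x) = shift (F x)"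
proof -
  obtain F' where F: "F \<in> extensional (orbit_closure \<eta>)"
    "homeomorphism (orbit_closure \<eta>) (orbit_closure \<eta>) F F'"
    "\<And>x. x \<in> orbit_closure \<eta> \<Longrightarrow> F (shift x) = shift (F x)"
    using assms by (auto simp: Aut_def)
  then show "F \<in> extensional (orbit_closure \<eta>)" "continuous_on (orbit_closure \<eta>) F"
    "x \<in> orbit_closure \<eta> \<Longrightarrow> F (shift x) = shift (F x)"
    by (auto simp: homeomorphism_def)
  show "x \<in> orbit_closure \<eta> \<Longrightarrow> F x \<in> orbit_closure \<eta>"
    using F(2) by (auto simp: homeomorphism_def)
  have "bij_betw F (orbit_closure \<eta>) (orbit_closure \<eta>)"
    using F(2) unfolding homeomorphism_def bij_betw_def by (metis inj_onI)
  then show "F \<in> Bij (orbit_closure \<eta>)"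
    using F(1) by (simp add: Bij_def)
qed

lemma Aut_shift_by:
  assumes F: "F \<in> carrier (Aut \<eta>)" and x: "x \<in> orbit_closure \<eta>"
  shows "F (shift_by k x) = shift_by k (F x)"
proof (induction k rule: int_induct[where k = 0])
  case (step1 i)
  have "shift_by (i + 1) y = shift (shift_by i y)" for y
    by (simp add: add.commute)
  then show ?case
    using step1 Aut_shift[OF F shift_by_in_orbit_closure[OF x]] by (simp only:)
next
  case (step2 i)
  have "shift (F (shift_by (i - 1) x)) = F (shift_by i x)"
    using Aut_shift[OF F shift_by_in_orbit_closure[OF x], of "i - 1"] by simp
  then have "shift_by (-1) (shift (F (shift_by (i - 1) x))) = shift_by (-1) (shift_by i (F x))"
    by (simp only: step2)
  then show ?case
    by simp
qed simp

lemma Aut_mult: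
  assumes "F \<in> carrier (Aut \<eta>)" "F' \<in> carrier (Aut \<eta>)"
  shows "F \<otimes>\<^bsub>Aut \<eta>\<^esub> F' = compose (orbit_closure \<eta>) F F'"
  using assms[THEN Aut_Bij] by (simp add: Aut_def BijGroup_def)

lemma Aut_one: "\<one>\<^bsub>Aut \<eta>\<^esub> = (\<lambda>x\<in>orbit_closure \<eta>. x)"
  by (simp add: Aut_def BijGroup_def)

section \<open>The group structure on automorphisms\<close>

lemma subgroup_Aut: "subgroup (carrier (Aut \<eta>)) (BijGroup (orbit_closure \<eta>))"
proof -
  let ?X = "orbit_closure \<eta>"
  interpret BijGroup: group "BijGroup ?X"
    by (rule group_BijGroup)
  have I: "F \<in> carrier (Aut \<eta>)"
    if "F \<in> extensional ?X" "homeomorphism ?X ?X F F'" "\<And>x. x \<in> ?X \<Longrightarrow> F (shift x) = shift (F x)" for F F'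
    using that by (auto simp: Aut_def)
  show ?thesis
  proof (rule BijGroup.subgroupI)
    show "carrier (Aut \<eta>) \<subseteq> carrier (BijGroup ?X)"
      using Aut_Bij by (auto simp: BijGroup_def)
    have "(\<lambda>x\<in>?X. x) \<in> carrier (Aut \<eta>)"
      by (rule I[of _ "\<lambda>x. x"])
        (auto simp: homeomorphism_def shift_by_in_orbit_closure cong: continuous_on_cong)
    then show "carrier (Aut \<eta>) \<noteq> {}"
      by auto
  next
    fix F assume F: "F \<in> carrier (Aut \<eta>)"
    then obtain F' where F': "homeomorphism ?X ?X F F'"
      by (auto simp: Aut_def)
    have F'X: "F' x \<in> ?X" "F (F' x) = x" if "x \<in> ?X" for x
      using F' that by (auto simp: homeomorphism_def)
    \<comment> \<open>The inverse in \<open>BijGroup\<close> is a set-theoretic one; identifying it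
      with \<open>F'\<close> on the subshift supplies its continuity.\<close>
    have inv: "inv_into ?X F x = F' x" if "x \<in> ?X" for x
      using F'X[OF that] Aut_Bij[OF F] by (auto simp: Bij_def bij_betw_def intro: inv_into_f_eq)
    have inv_eq: "inv\<^bsub>BijGroup ?X\<^esub> F = restrict F' ?X"
      by (simp add: inv_BijGroup[OF Aut_Bij[OF F]] inv cong: restrict_cong)
    show "inv\<^bsub>BijGroup ?X\<^esub> F \<in> carrier (Aut \<eta>)"
      unfolding inv_eq
    proof (rule I)
      show "homeomorphism ?X ?X (restrict F' ?X) F"
        using homeomorphism_cong[OF homeomorphism_symD[OF F']] by auto
      fix x assume x: "x \<in> ?X"
      \<comment> \<open>Equivariance of \<open>F'\<close> follows by applying \<open>F\<close> to
        both sides and using its injectivity.\<close>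
      have "F (shift (F' x)) = F (F' (shift x))"
        using Aut_shift[OF F] F'X x shift_by_in_orbit_closure by metis
      then have "shift (F' x) = F' (shift x)"
        using Aut_Bij[OF F] F'X x shift_by_in_orbit_closure
        unfolding Bij_def bij_betw_def by (metis (no_types, lifting) CollectD Int_iff inj_onD)
      then show "restrict F' ?X (shift x) = shift (restrict F' ?X x)"
        using x by (simp add: shift_by_in_orbit_closure)
    qed simp
  next
    fix F E assume F: "F \<in> carrier (Aut \<eta>)" and E: "E \<in> carrier (Aut \<eta>)"
    obtain F' E' where "homeomorphism ?X ?X F F'" "homeomorphism ?X ?X E E'"
      using F E by (auto simp: Aut_def)
    then have "homeomorphism ?X ?X (F \<circ> E) (E' \<circ> F')"
      using homeomorphism_compose by blast
    then have hom: "homeomorphism ?X ?X (compose ?X F E) (E' \<circ> F')"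
      by (rule homeomorphism_cong) (auto simp: compose_def)
    show "F \<otimes>\<^bsub>BijGroup ?X\<^esub> E \<in> carrier (Aut \<eta>)"
      using Aut_Bij[OF F] Aut_Bij[OF E] I[OF _ hom] Aut_shift[OF F] Aut_shift[OF E] Aut_in[OF E]
      by (auto simp: BijGroup_def compose_def shift_by_in_orbit_closure)
  qed
qed

lemma group_Aut: "group (Aut \<eta>)"
  using group.subgroup_imp_group[OF group_BijGroup subgroup_Aut] by (simp add: Aut_def)

lemma shift_aut_in_Aut: "shift_aut \<eta> \<in> carrier (Aut \<eta>)"
proof -
  let ?X = "orbit_closure \<eta>"
  have "shift_by k ` ?X = ?X" for k
  proof (intro equalityI subsetI)
    fix x assume "x \<in> ?X"
    then have "shift_by k (shift_by (- k) x) \<in> shift_by k ` ?X"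
      by (intro imageI shift_by_in_orbit_closure)
    then show "x \<in> shift_by k ` ?X"
      by simp
  qed (auto intro: shift_by_in_orbit_closure)
  then have "homeomorphism ?X ?X shift (shift_by (-1))"
    by (simp add: homeomorphism_def continuous_on_shift_by)
  then have "homeomorphism ?X ?X (shift_aut \<eta>) (shift_by (-1))"
    by (rule homeomorphism_cong) (auto simp: shift_aut_def)
  then show ?thesis
    by (auto simp: Aut_def shift_aut_def shift_by_in_orbit_closure)
qed

section \<open>The boundary of the window and the essential holes\<close>

locale toeplitz =
  fixes \<eta> :: "int \<Rightarrow> bool" and p :: "nat \<Rightarrow> nat"
  assumes toeplitz: "nonperiodic_toeplitz \<eta> p"
begin

abbreviation "X \<equiv> orbit_closure \<eta>"
abbreviation "G \<equiv> odometer p"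
abbreviation "P n i \<equiv> const_positions \<eta> p n i"
abbreviation "H n \<equiv> holes \<eta> p n"
abbreviation "V i \<equiv> const_region \<eta> p i"
abbreviation "dW \<equiv> window_boundary \<eta> p"

lemma p_pos [simp]: "0 < p n"
  using toeplitz by (simp add: nonperiodic_toeplitz_def period_structure_def)

lemma p_dvd: "m \<le> n \<Longrightarrow> p m dvd p n"
proof (induction n rule: dec_induct)
  case (step n)
  moreover have "p n dvd p (Suc n)"
    using toeplitz by (simp add: nonperiodic_toeplitz_def period_structure_def)
  ultimately show ?case
    using dvd_trans by blast
qed simp

lemma toeplitz_const: obtains n where "k \<in> P n (\<eta> k)"
  using toeplitz unfolding nonperiodic_toeplitz_def const_positions_def by blast

lemma P_mod: "k mod int (p n) \<in> P n i \<longleftrightarrow> k \<in> P n i"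
proof -
  have eq: "k + int (p n) * m = k mod int (p n) + int (p n) * (k div int (p n) + m)" for m
    by (simp add: algebra_simps)
  show ?thesis
  proof
    assume "k mod int (p n) \<in> P n i"
    then show "k \<in> P n i"
      unfolding const_positions_def by (simp add: eq)
  next
    assume k: "k \<in> P n i"
    have "\<eta> (k mod int (p n) + int (p n) * m) = i" for m
    proof -
      have "k mod int (p n) + int (p n) * m = k + int (p n) * (m - k div int (p n))"
        by (simp add: algebra_simps)
      then show ?thesis
        using k unfolding const_positions_def by auto
    qed
    then show "k mod int (p n) \<in> P n i"
      by (simp add: const_positions_def)
  qed
qed

lemma P_cong: "k mod int (p n) = l mod int (p n) \<Longrightarrow> k \<in> P n i \<longleftrightarrow> l \<in> P n i"
  by (metis P_mod)

lemma P_mono: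
  assumes "m \<le> n" shows "P m i \<subseteq> P n i"
proof
  fix k assume k: "k \<in> P m i"
  obtain q where "p n = p m * q"
    using p_dvd[OF assms] by (auto elim: dvdE)
  then have "\<eta> (k + int (p n) * j) = i" for j
    using k unfolding const_positions_def by (simp add: mult.assoc)
  then show "k \<in> P n i"
    by (simp add: const_positions_def)
qed

lemma P_value: "k \<in> P n i \<Longrightarrow> \<eta> k = i"
  by (auto simp: const_positions_def dest: spec[of _ 0])

lemma H_iff: "k \<in> H n \<longleftrightarrow> (\<forall>i. k \<notin> P n i)"
  unfolding holes_def by (auto simp: all_bool_eq)

lemma H_cong: "k mod int (p n) = l mod int (p n) \<Longrightarrow> k \<in> H n \<longleftrightarrow> l \<in> H n"
  unfolding H_iff using P_cong by blast

lemma H_antimono: "m \<le> n \<Longrightarrow> H n \<subseteq> H m"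
  using P_mono unfolding H_iff subset_iff by blast

section \<open>The odometer in coordinates and its topology\<close>

lemma G_iff: "g \<in> carrier G \<longleftrightarrow>
    (\<forall>n. 0 \<le> g n \<and> g n < int (p n)) \<and> (\<forall>n. g (Suc n) mod int (p n) = g n)"
  by (auto simp: odometer_def carrier_integer_mod_group order_less_imp_not_eq2)

lemma G_mult: "g \<otimes>\<^bsub>G\<^esub> h = (\<lambda>n. (g n + h n) mod int (p n))"
  by (auto simp: odometer_def)

lemma G_bounds:
  assumes "g \<in> carrier G"
  shows G_nonneg: "0 \<le> g n" and G_less: "g n < int (p n)" and G_mod_self: "g n mod int (p n) = g n"
  using assms by (auto simp: G_iff)

lemma G_mod:
  assumes g: "g \<in> carrier G" and "m \<le> n"
  shows "g n mod int (p m) = g m"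
  using \<open>m \<le> n\<close>
proof (induction n rule: dec_induct)
  case (step n)
  have "int (p m) dvd int (p n)"
    using p_dvd step by auto
  then have "g (Suc n) mod int (p m) = g (Suc n) mod int (p n) mod int (p m)"
    by (simp add: mod_mod_cancel)
  then show ?case
    using g step by (auto simp: G_iff)
qed (use G_mod_self[OF g] in simp)

text \<open>Allows points of the inverse limit to be built from integers that are compatible but not
  yet reduced.\<close>

lemma G_I:
  assumes "\<And>n. [h (Suc n) = h n] (mod int (p n))"
  shows "(\<lambda>n. h n mod int (p n)) \<in> carrier G"
  using assms p_dvd[of _ "Suc _"]
  by (auto simp: G_iff mod_mod_cancel cong_def)

lemma int_embed_G: "int_embed p k \<in> carrier G"
  using G_I[of "\<lambda>_. k"] by (simp add: int_embed_def)

lemma open_odometer_coordinate: "openin (odometer_topology p) {g \<in> carrier G. Q (g n)}"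
proof -
  have "open ((\<lambda>g::nat \<Rightarrow> int. g n) -` {a. Q a})"
    by (intro open_vimage open_discrete continuous_on_product_coordinates)
  then show ?thesis
    unfolding odometer_topology_def openin_open by (auto intro!: exI[of _ "(\<lambda>g. g n) -` {a. Q a}"])
qed

lemma topspace_odometer [simp]: "topspace (odometer_topology p) = carrier G"
  by (simp add: odometer_topology_def)

text \<open>A basic open set constrains finitely many coordinates, and in the inverse limit a
  coordinate \<open>N\<close> beyond them determines them all.\<close>

lemma odometer_nhd_cylinder:
  assumes U: "openin (odometer_topology p) U" and g: "g \<in> U"
  obtains N where "\<And>h. h \<in> carrier G \<Longrightarrow> h N = g N \<Longrightarrow> h \<in> U"
proof -
  obtain U' where U': "open U'" "U = carrier G \<inter> U'"
    using U by (auto simp: odometer_topology_def openin_open)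
  then have "openin (product_topology (\<lambda>i. euclidean) UNIV) U'" "g \<in> U'"
    using g by (auto simp: open_fun_def)
  from product_topology_open_contains_basis[OF this] obtain Y where
    Y: "g \<in> (\<Pi>\<^sub>E i\<in>UNIV. Y i)" "finite {i. Y i \<noteq> UNIV}" "(\<Pi>\<^sub>E i\<in>UNIV. Y i) \<subseteq> U'"
    by auto
  obtain N where N: "\<And>i. Y i \<noteq> UNIV \<Longrightarrow> i \<le> N"
    using Y(2) by (auto simp: finite_nat_set_iff_bounded_le)
  have "h \<in> U" if h: "h \<in> carrier G" "h N = g N" for h
  proof -
    have "h i \<in> Y i" for i
    proof (cases "Y i = UNIV")
      case False
      have "g \<in> carrier G"
        using g U' by auto
      then have "h i = g i"
        using G_mod[OF _ N[OF False]] h by metis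
      then show ?thesis
        using Y(1) by (auto simp: PiE_iff)
    qed auto
    then show ?thesis
      using Y(3) h U' by (auto simp: PiE_iff subset_iff)
  qed
  then show thesis
    by (rule that)
qed

section \<open>Constant regions and the boundary of the window\<close>

lemma V_iff: "g \<in> V i \<longleftrightarrow> g \<in> carrier G \<and> (\<exists>n. g n \<in> P n i)"
proof
  assume "g \<in> V i"
  then show "g \<in> carrier G \<and> (\<exists>n. g n \<in> P n i)"
    by (auto simp: const_region_def cylinder_def int_embed_def)
next
  assume "g \<in> carrier G \<and> (\<exists>n. g n \<in> P n i)"
  then obtain n where g: "g \<in> carrier G" and n: "g n \<in> P n i"
    by auto
  then have "g \<in> cylinder p n (int_embed p (g n))" "g n \<in> P n i \<inter> {0..<int (p n)}"
    by (auto simp: cylinder_def int_embed_def G_bounds)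
  then show "g \<in> V i"
    unfolding const_region_def by blast
qed

lemma openin_V: "openin (odometer_topology p) (V i)"
proof -
  have "V i = (\<Union>n. {g \<in> carrier G. g n \<in> P n i})"
    by (auto simp: V_iff)
  then show ?thesis
    using open_odometer_coordinate[of "\<lambda>a. a \<in> P _ i"] by (auto intro!: openin_Union)
qed

text \<open>At level \<open>max m n\<close> the coordinate of \<open>g\<close> is an integer
  position at which \<open>\<eta>\<close> takes both values \<open>i\<close> and
  \<open>j\<close>.\<close>

lemma V_disjoint: "g \<in> V i \<Longrightarrow> g \<in> V j \<Longrightarrow> i = j"
proof -
  assume "g \<in> V i" "g \<in> V j"
  then obtain m n where g: "g \<in> carrier G" and mn: "g m \<in> P m i" "g n \<in> P n j"
    by (auto simp: V_iff)
  have "g (max m n) \<in> P m i" "g (max m n) \<in> P n j"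
    using mn P_mod[of "g (max m n)"] G_mod[OF g, of _ "max m n"] by (metis max.cobounded1 max.cobounded2)+
  then show "i = j"
    using P_value by blast
qed

text \<open>One inclusion holds because \<open>V (\<not> i)\<close> is open and disjoint from
  \<open>V i\<close>. For the other, if \<open>g N\<close> is not a constant position for
  \<open>\<not> i\<close>, its residue class contains an integer where \<open>\<eta>\<close> is
  \<open>i\<close>. The Toeplitz property puts the image of that integer in \<open>V i\<close>, and
  it agrees with \<open>g\<close> at level \<open>N\<close>.\<close>

lemma closure_V: "odometer_topology p closure_of V i = carrier G - V (\<not> i)"
proof (intro equalityI subsetI)
  fix g assume "g \<in> odometer_topology p closure_of V i"
  then show "g \<in> carrier G - V (\<not> i)"
    using openin_V[of "\<not> i"] V_disjoint[of _ i "\<not> i"] unfolding in_closure_of by auto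
next
  fix g assume g: "g \<in> carrier G - V (\<not> i)"
  have "\<exists>h. h \<in> V i \<and> h \<in> U" if U: "g \<in> U" "openin (odometer_topology p) U" for U
  proof -
    obtain N where N: "\<And>h. h \<in> carrier G \<Longrightarrow> h N = g N \<Longrightarrow> h \<in> U"
      using odometer_nhd_cylinder[OF U(2,1)] by auto
    have "g N \<notin> P N (\<not> i)"
      using g by (auto simp: V_iff)
    then obtain m where m: "\<eta> (g N + int (p N) * m) = i"
      by (auto simp: const_positions_def)
    let ?k = "g N + int (p N) * m"
    obtain n where "?k \<in> P n i"
      using toeplitz_const[of ?k] m by auto
    then have "int_embed p ?k \<in> V i"
      using int_embed_G by (auto simp: V_iff int_embed_def P_mod)
    moreover have "int_embed p ?k N = g N"
      using g by (simp add: int_embed_def G_mod_self)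
    ultimately show ?thesis
      using N int_embed_G by blast
  qed
  then show "g \<in> odometer_topology p closure_of V i"
    using g by (auto simp: in_closure_of)
qed

text \<open>The window is closed with complement \<open>V False\<close>, and its interior is
  \<open>V True\<close>, the complement of the closure of \<open>V False\<close>. What remains is
  the set of points in neither region, that is, with a hole in every coordinate.\<close>

lemma window_boundary_iff: "g \<in> dW \<longleftrightarrow> g \<in> carrier G \<and> (\<forall>n. g n \<in> H n)"
proof -
  have "odometer_topology p interior_of (carrier G - V False) = V True"
    using interior_of_complement[of "odometer_topology p" "V False"] openin_subset[OF openin_V, of True]
    by (simp add: closure_V double_diff)
  moreover have "odometer_topology p closure_of (carrier G - V False) = carrier G - V False"
    using closure_of_closure_of[of "odometer_topology p" "V True"] by (simp add: closure_V)
  ultimately have "dW = carrier G - V False - V True"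
    unfolding window_boundary_def window_def frontier_of_def by (simp add: closure_V)
  then show ?thesis
    by (auto simp: V_iff H_iff all_bool_eq)
qed

text \<open>
  Koenig's lemma: essential holes are the positions at which the hole tree has an infinite
  branch, and the branches are the points of the boundary.
\<close>

lemma essential_hole_lift:
  assumes k: "k \<in> essential_holes \<eta> p N"
  shows "\<exists>l. l \<in> essential_holes \<eta> p (Suc N) \<and> l mod int (p N) = k mod int (p N)"
proof -
  have "\<forall>n. \<exists>l. n \<ge> Suc N \<longrightarrow> l \<in> H n \<and> l mod int (p N) = k mod int (p N)"
  proof
    fix n
    show "\<exists>l. n \<ge> Suc N \<longrightarrow> l \<in> H n \<and> l mod int (p N) = k mod int (p N)"
    proof (cases "n \<ge> Suc N")
      case True
      then have "H n \<inter> range (\<lambda>m. k + int (p N) * m) \<noteq> {}"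
        using k by (simp add: essential_holes_def)
      then show ?thesis
        by auto
    qed auto
  qed
  then obtain l where l: "\<And>n. n \<ge> Suc N \<Longrightarrow> l n \<in> H n \<and> l n mod int (p N) = k mod int (p N)"
    by metis
  \<comment> \<open>By the pigeonhole principle infinitely many \<open>l n\<close> share one residue
    modulo \<open>p (Suc N)\<close>. Holes of high level are holes of every lower level, so this
    residue class contains holes of all levels.\<close>
  have "finite ((\<lambda>n. l n mod int (p (Suc N))) ` {Suc N..})"
    by (rule finite_subset[of _ "{0..<int (p (Suc N))}"]) auto
  moreover have "infinite {Suc N..}"
    by (rule infinite_Ici)
  ultimately obtain n0 where n0: "n0 \<in> {Suc N..}"
    and inf: "infinite {n \<in> {Suc N..}. l n mod int (p (Suc N)) = l n0 mod int (p (Suc N))}"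
    using pigeonhole_infinite[of "{Suc N..}" "\<lambda>n. l n mod int (p (Suc N))"] by auto
  have hole: "H n \<inter> range (\<lambda>m. l n0 + int (p (Suc N)) * m) \<noteq> {}" for n
  proof -
    obtain n' where n': "n' \<ge> n" "n' \<ge> Suc N"
      "l n' mod int (p (Suc N)) = l n0 mod int (p (Suc N))"
      using inf by (auto simp: infinite_nat_iff_unbounded_le)
    then obtain m where "l n' = l n0 + int (p (Suc N)) * m"
      by (metis mod_eqE)
    moreover have "l n' \<in> H n"
      using l[OF n'(2)] H_antimono[OF n'(1)] by auto
    ultimately show ?thesis
      by blast
  qed
  have "l n0 \<in> H (Suc N)"
    using l[of n0] n0 H_antimono[of "Suc N" n0] by auto
  then have "l n0 \<in> essential_holes \<eta> p (Suc N)"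
    using hole by (simp add: essential_holes_def)
  then show ?thesis
    using l[of n0] n0 by auto
qed

lemma essential_holes_iff:
  "k \<in> essential_holes \<eta> p N \<longleftrightarrow> (\<exists>g\<in>dW. g N = k mod int (p N))"
proof
  assume k: "k \<in> essential_holes \<eta> p N"
  \<comment> \<open>Iterating the lift by dependent choice produces an infinite branch that starts
    at \<open>k\<close> on level \<open>N\<close>.\<close>
  have "\<exists>f. \<forall>n. (f n \<in> essential_holes \<eta> p (N + n) \<and> (n = 0 \<longrightarrow> f n = k)) \<and>
      f (Suc n) mod int (p (N + n)) = f n mod int (p (N + n))"
    by (rule dependent_nat_choice) (use k essential_hole_lift in auto)
  then obtain f where f: "\<And>n. f n \<in> essential_holes \<eta> p (N + n)" "f 0 = k"
      "\<And>n. f (Suc n) mod int (p (N + n)) = f n mod int (p (N + n))"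
    by blast
  \<comment> \<open>Truncated subtraction makes \<open>h\<close> constantly \<open>k\<close> up to
    level \<open>N\<close>, so below \<open>N\<close> the branch consists of reductions of
    \<open>k\<close>.\<close>
  define h where "h n = f (n - N)" for n
  define g where "g = (\<lambda>n. h n mod int (p n))"
  have "[h (Suc n) = h n] (mod int (p n))" for n
  proof (cases "n < N")
    case False
    then show ?thesis
      using f(3)[of "n - N"] by (simp add: h_def Suc_diff_le cong_def)
  qed (simp add: h_def)
  then have gG: "g \<in> carrier G"
    unfolding g_def by (rule G_I)
  have hole: "g n \<in> H n" if "n \<ge> N" for n
  proof -
    have "h n \<in> H n"
      using f(1)[of "n - N"] that by (simp add: h_def essential_holes_def)
    then show ?thesis
      using H_cong[of "g n" n "h n"] by (simp add: g_def)
  qed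
  have "g n \<in> H n" for n
  proof (cases "n \<ge> N")
    case False
    then have "g N \<in> H n" "g N mod int (p n) = g n mod int (p n)"
      using hole[of N] H_antimono[of n N] G_mod[OF gG, of n N] G_mod_self[OF gG] by auto
    then show ?thesis
      using H_cong by blast
  qed (rule hole)
  then have "g \<in> dW"
    using gG by (simp add: window_boundary_iff)
  moreover have "g N = k mod int (p N)"
    by (simp add: g_def h_def f)
  ultimately show "\<exists>g\<in>dW. g N = k mod int (p N)"
    by blast
next
  assume "\<exists>g\<in>dW. g N = k mod int (p N)"
  then obtain g where g: "g \<in> carrier G" "\<And>n. g n \<in> H n" "g N = k mod int (p N)"
    by (auto simp: window_boundary_iff)
  have "k \<in> H N"
    using g(2)[of N] H_cong[of "g N" N k] g(3) by simp
  moreover have "H n \<inter> range (\<lambda>m. k + int (p N) * m) \<noteq> {}" if "n \<ge> N" for n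
  proof -
    have "g n mod int (p N) = k mod int (p N)"
      using G_mod[OF g(1) that] g(3) by simp
    then obtain m where "g n = k + int (p N) * m"
      by (metis mod_eqE)
    then show ?thesis
      using g(2)[of n] by auto
  qed
  ultimately show "k \<in> essential_holes \<eta> p N"
    by (simp add: essential_holes_def)
qed

section \<open>Divisibility by the hole period\<close>

lemma hole_period_dvd_period: "hole_period \<eta> p n dvd p n"
proof -
  have per: "k + int (p n) \<in> essential_holes \<eta> p n \<longleftrightarrow> k \<in> essential_holes \<eta> p n" for k
    by (simp add: essential_holes_iff)
  have "int (minimal_period (essential_holes \<eta> p n)) dvd int (p n)"
    by (rule minimal_period_dvd[OF p_pos per]) (simp add: per)
  then show ?thesis
    by (simp add: hole_period_def)
qed

text \<open>The boundary projects onto the essential holes modulo \<open>p n\<close>. The assumed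
  inclusion thus says that translation by \<open>y - k\<close> maps essential holes to essential
  holes, as \<open>minimal_period_dvd\<close> requires.\<close>

lemma hole_period_dvd_if_boundary_translate:
  assumes y: "\<And>g. g \<in> dW \<Longrightarrow> \<exists>g'\<in>dW. [g n + y = g' n + k] (mod int (p n))"
  shows "int (hole_period \<eta> p n) dvd y - k"
  unfolding hole_period_def
proof (rule minimal_period_dvd[OF p_pos[of n]])
  show "l + int (p n) \<in> essential_holes \<eta> p n \<longleftrightarrow> l \<in> essential_holes \<eta> p n" for l
    by (simp add: essential_holes_iff)
  fix l assume "l \<in> essential_holes \<eta> p n"
  then obtain g where g: "g \<in> dW" "g n = l mod int (p n)"
    by (auto simp: essential_holes_iff)
  with y obtain g' where g': "g' \<in> dW" "[g n + y = g' n + k] (mod int (p n))"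
    by blast
  have "[g' n + k - k = g n + y - k] (mod int (p n))"
    by (intro cong_diff cong_sym[OF g'(2)] cong_refl)
  also have "[g n + y - k = l + y - k] (mod int (p n))"
    by (intro cong_diff cong_add cong_refl) (simp add: g cong_def)
  finally have "g' n = (l + (y - k)) mod int (p n)"
    using g'(1) by (simp add: cong_def window_boundary_iff G_mod_self algebra_simps)
  then show "l + (y - k) \<in> essential_holes \<eta> p n"
    using g' by (auto simp: essential_holes_iff)
qed

end

section \<open>Automorphisms and their translations\<close>

locale toeplitz_factor = toeplitz +
  fixes \<pi> :: "(int \<Rightarrow> bool) \<Rightarrow> nat \<Rightarrow> int"
  assumes factor: "odometer_factor_map \<eta> p \<pi>"
begin

abbreviation "T n F \<equiv> translation \<eta> p \<pi> F n"

lemma \<pi>_eta: "\<pi> \<eta> = int_embed p 0"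
  using factor by (simp add: odometer_factor_map_def)

lemma \<pi>_in_G: "x \<in> X \<Longrightarrow> \<pi> x \<in> carrier G"
  using factor by (auto simp: odometer_factor_map_def)

lemma continuous_on_\<pi>: "continuous_on X (\<lambda>x. \<pi> x n)"
  using factor by (auto simp: odometer_factor_map_def intro: continuous_on_product_then_coordinatewise)

lemma \<pi>_shift: "x \<in> X \<Longrightarrow> \<pi> (shift x) n = (\<pi> x n + 1) mod int (p n)"
  using factor by (simp add: odometer_factor_map_def G_mult int_embed_def mod_add_right_eq)

lemma \<pi>_shift_by:
  assumes x: "x \<in> X" shows "\<pi> (shift_by k x) n = (\<pi> x n + k) mod int (p n)"
proof (induction k rule: int_induct[where k = 0])
  case base
  then show ?case
    using G_mod_self[OF \<pi>_in_G[OF x]] by simp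
next
  case (step1 i)
  have "shift_by (i + 1) x = shift (shift_by i x)"
    by (simp add: add.commute)
  then show ?case
    using \<pi>_shift[OF shift_by_in_orbit_closure[OF x], of i n] step1
    by (simp add: mod_add_left_eq add.assoc)
next
  case (step2 i)
  have "\<pi> (shift_by i x) n = (\<pi> (shift_by (i - 1) x) n + 1) mod int (p n)"
    using \<pi>_shift[OF shift_by_in_orbit_closure[OF x], of "i - 1" n] by simp
  then have "[\<pi> (shift_by (i - 1) x) n + 1 = (\<pi> x n + (i - 1)) + 1] (mod int (p n))"
    using step2 by (simp add: cong_def)
  then have "[\<pi> (shift_by (i - 1) x) n = \<pi> x n + (i - 1)] (mod int (p n))"
    by (simp only: cong_add_rcancel)
  then show ?case
    using G_mod_self[OF \<pi>_in_G[OF shift_by_in_orbit_closure[OF x]]] by (simp add: cong_def)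
qed

lemma \<pi>_orbit: "\<pi> (shift_by k \<eta>) n = k mod int (p n)"
  using \<pi>_shift_by[of \<eta> k n] by (simp add: \<pi>_eta int_embed_def)

text \<open>Let \<open>\<eta>\<close> be constant along \<open>i\<close> modulo \<open>p n\<close>.
  A shift of \<open>\<eta>\<close> by \<open>k\<close> that agrees with \<open>x\<close> at position
  \<open>i\<close> and in \<open>\<pi>\<close> at level \<open>n\<close> has \<open>k\<close>
  divisible by \<open>p n\<close>, so it has the value \<open>\<eta> i\<close> there.\<close>

lemma fibre_0:
  assumes x: "x \<in> X" and 0: "\<And>n. \<pi> x n = 0"
  shows "x = \<eta>"
proof
  fix i
  obtain n where n: "i \<in> P n (\<eta> i)"
    by (rule toeplitz_const)
  have "continuous_on X (\<lambda>x. x i)"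
    using continuous_on_subset[OF continuous_on_product_coordinates] by auto
  then obtain k where k: "shift_by k \<eta> i = x i" "\<pi> (shift_by k \<eta>) n = \<pi> x n"
    using orbit_closure_approx[OF _ continuous_on_\<pi> x] by blast
  then have "int (p n) dvd k"
    by (simp add: \<pi>_orbit 0 dvd_eq_mod_eq_0)
  then have "\<eta> (i + k) = \<eta> i"
    using n by (auto simp: const_positions_def elim!: dvdE)
  then show "x i = \<eta> i"
    using k by (simp add: shift_by_apply)
qed

text \<open>On the orbit of \<open>\<eta>\<close> this is equivariance under the shift;
  approximation extends it to the closure, since both \<open>\<pi>\<close> and its composite with
  \<open>F\<close> are continuous with integer coordinates.\<close>

lemma \<pi>_Aut:
  assumes F: "F \<in> carrier (Aut \<eta>)" and x: "x \<in> X"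
  shows "\<pi> (F x) n = (\<pi> x n + \<pi> (F \<eta>) n) mod int (p n)"
proof -
  have "F ` X \<subseteq> X"
    using Aut_in[OF F] by auto
  then have "continuous_on X (\<lambda>x. \<pi> (F x) n)"
    using continuous_on_compose2[OF continuous_on_\<pi> Aut_continuous[OF F]] by auto
  then obtain k where "\<pi> (F (shift_by k \<eta>)) n = \<pi> (F x) n" "\<pi> (shift_by k \<eta>) n = \<pi> x n"
    using orbit_closure_approx[OF _ continuous_on_\<pi> x] by blast
  moreover have "\<pi> (F (shift_by k \<eta>)) n = (\<pi> (F \<eta>) n + k) mod int (p n)"
    using F by (simp add: Aut_shift_by \<pi>_shift_by Aut_in)
  ultimately show ?thesis
    by (metis \<pi>_orbit add.commute mod_add_right_eq)
qed

text \<open>As \<open>\<eta>\<close> lies over 0, evaluation there leaves only one candidate, and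
  \<open>\<pi>_Aut\<close> shows that it works. This eliminates the definite description.\<close>

lemma translation_eq:
  assumes F: "F \<in> carrier (Aut \<eta>)"
  shows "translation \<eta> p \<pi> F = \<pi> (F \<eta>)"
  unfolding translation_def
proof (rule the_equality)
  show "\<pi> (F \<eta>) \<in> carrier G \<and> (\<forall>x\<in>X. \<pi> (F x) = \<pi> x \<otimes>\<^bsub>G\<^esub> \<pi> (F \<eta>))"
  proof
    show "\<pi> (F \<eta>) \<in> carrier G"
      by (simp add: \<pi>_in_G Aut_in F)
    show "\<forall>x\<in>X. \<pi> (F x) = \<pi> x \<otimes>\<^bsub>G\<^esub> \<pi> (F \<eta>)"
      unfolding G_mult by (intro ballI ext \<pi>_Aut[OF F])
  qed
  fix y assume y: "y \<in> carrier G \<and> (\<forall>x\<in>X. \<pi> (F x) = \<pi> x \<otimes>\<^bsub>G\<^esub> y)"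
  then have "\<pi> (F \<eta>) = \<pi> \<eta> \<otimes>\<^bsub>G\<^esub> y"
    by simp
  then show "y = \<pi> (F \<eta>)"
    using y by (simp add: G_mult \<pi>_eta int_embed_def G_mod_self)
qed

section \<open>Translations as separating homomorphisms\<close>

lemma translation_in_G: "F \<in> carrier (Aut \<eta>) \<Longrightarrow> translation \<eta> p \<pi> F \<in> carrier G"
  by (simp add: translation_eq \<pi>_in_G Aut_in)

lemma translation_mult:
  assumes F: "F \<in> carrier (Aut \<eta>)" and E: "E \<in> carrier (Aut \<eta>)"
  shows "T n (F \<otimes>\<^bsub>Aut \<eta>\<^esub> E) = (T n F + T n E) mod int (p n)"
proof -
  have "F \<otimes>\<^bsub>Aut \<eta>\<^esub> E \<in> carrier (Aut \<eta>)"
    using group.is_monoid[OF group_Aut] F E by (simp add: monoid.m_closed)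
  then show ?thesis
    using \<pi>_Aut[OF F Aut_in[OF E], of \<eta> n] F E
    by (simp add: translation_eq Aut_mult compose_eq add.commute)
qed

text \<open>The image of \<open>\<eta>\<close> lies over 0 and so equals \<open>\<eta>\<close>.
  Hence \<open>F\<close> fixes the orbit pointwise, and by approximation in each coordinate the
  whole closure.\<close>

lemma translation_zero_imp_one:
  assumes F: "F \<in> carrier (Aut \<eta>)" and 0: "\<And>n. T n F = 0"
  shows "F = \<one>\<^bsub>Aut \<eta>\<^esub>"
proof -
  have "F \<eta> = \<eta>"
    using fibre_0[OF Aut_in[OF F]] 0 by (simp add: translation_eq F)
  then have orb: "F (shift_by k \<eta>) = shift_by k \<eta>" for k
    by (simp add: Aut_shift_by[OF F])
  have "F x = x" if x: "x \<in> X" for x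
  proof
    fix i
    have "continuous_on X (\<lambda>x. x i)" "continuous_on X (\<lambda>x. F x i)"
      using continuous_on_subset[OF continuous_on_product_coordinates]
        continuous_on_product_then_coordinatewise[OF Aut_continuous[OF F]] by auto
    then obtain k where "shift_by k \<eta> i = x i" "F (shift_by k \<eta>) i = F x i"
      using orbit_closure_approx[OF _ _ x] by blast
    then show "F x i = x i"
      by (simp add: orb)
  qed
  then show ?thesis
    using Aut_extensional[OF F] by (auto simp: Aut_one intro: extensionalityI[of _ X])
qed

lemma translation_shift_aut: "T n (shift_aut \<eta>) = 1 mod int (p n)"
  unfolding translation_eq[OF shift_aut_in_Aut]
  using \<pi>_orbit[of 1 n] by (simp add: shift_aut_def)

sublocale Aut: residue_homs "Aut \<eta>" p "\<lambda>n F. T n F"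
proof -
  interpret group "Aut \<eta>"
    by (rule group_Aut)
  show "residue_homs (Aut \<eta>) p (\<lambda>n F. T n F)"
  proof
    show "(\<lambda>F. T n F) \<in> hom (Aut \<eta>) (integer_mod_group (p n))" for n
      using translation_in_G p_pos[of n]
      by (auto simp: hom_def translation_mult G_bounds carrier_integer_mod_group)
    show "T n F = 0" if "F \<in> carrier (Aut \<eta>)" "T (Suc n) F = 0" for n F
      using that G_mod[OF translation_in_G, of F n "Suc n"] by simp
  qed (auto intro: translation_zero_imp_one)
qed

section \<open>Inclusions of the translated boundary\<close>

lemma boundary_shift_iff:
  assumes F: "F \<in> carrier (Aut \<eta>)"
  shows "boundary_shift \<eta> p \<pi> F k \<longleftrightarrow>
    (\<forall>g\<in>dW. \<exists>g'\<in>dW. \<forall>n. [g n + T n F = g' n + k] (mod int (p n)))"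
proof -
  have "boundary_shift \<eta> p \<pi> F k \<longleftrightarrow>
      (\<forall>g\<in>dW. \<exists>g'\<in>dW. g \<otimes>\<^bsub>G\<^esub> translation \<eta> p \<pi> F = g' \<otimes>\<^bsub>G\<^esub> int_embed p k)"
    unfolding boundary_shift_def r_coset_def by blast
  then show ?thesis
    by (simp add: G_mult int_embed_def fun_eq_iff cong_def mod_add_right_eq)
qed

lemma hole_period_dvd_translation:
  assumes F: "F \<in> carrier (Aut \<eta>)" and k: "boundary_shift \<eta> p \<pi> F k"
  shows "int (hole_period \<eta> p n) dvd T n F - k"
  using k unfolding boundary_shift_iff[OF F]
  by (intro hole_period_dvd_if_boundary_translate) blast

text \<open>Chaining the two inclusions adds the translations and the integers, because the odometer
  is abelian. Together with uniqueness this makes the integer attached to an automorphism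
  additive.\<close>

lemma boundary_shift_mult:
  assumes F: "F \<in> carrier (Aut \<eta>)" "boundary_shift \<eta> p \<pi> F k"
    and E: "E \<in> carrier (Aut \<eta>)" "boundary_shift \<eta> p \<pi> E l"
  shows "boundary_shift \<eta> p \<pi> (F \<otimes>\<^bsub>Aut \<eta>\<^esub> E) (k + l)"
  unfolding boundary_shift_iff[OF Aut.m_closed[OF F(1) E(1)]]
proof
  fix g assume "g \<in> dW"
  then obtain g' where g': "g' \<in> dW" "\<And>n. [g n + T n F = g' n + k] (mod int (p n))"
    using F by (auto simp: boundary_shift_iff)
  then obtain g'' where g'': "g'' \<in> dW" "\<And>n. [g' n + T n E = g'' n + l] (mod int (p n))"
    using E by (auto simp: boundary_shift_iff)
  have "[g n + T n (F \<otimes>\<^bsub>Aut \<eta>\<^esub> E) = g'' n + (k + l)] (mod int (p n))" for n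
  proof -
    have "[g n + T n (F \<otimes>\<^bsub>Aut \<eta>\<^esub> E) = (g n + T n F) + T n E] (mod int (p n))"
      by (simp add: translation_mult F E cong_def mod_add_right_eq add.assoc)
    also have "[(g n + T n F) + T n E = (g' n + k) + T n E] (mod int (p n))"
      by (intro cong_add g' cong_refl)
    also have "(g' n + k) + T n E = (g' n + T n E) + k"
      by simp
    also have "[(g' n + T n E) + k = (g'' n + l) + k] (mod int (p n))"
      by (intro cong_add g'' cong_refl)
    finally show ?thesis
      by (simp add: algebra_simps)
  qed
  then show "\<exists>g'\<in>dW. \<forall>n. [g n + T n (F \<otimes>\<^bsub>Aut \<eta>\<^esub> E) = g' n + (k + l)] (mod int (p n))"
    using g''(1) by blast
qed

lemma boundary_shift_shift_aut: "boundary_shift \<eta> p \<pi> (shift_aut \<eta>) 1"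
  unfolding boundary_shift_iff[OF shift_aut_in_Aut]
  by (auto simp: translation_shift_aut cong_def mod_add_right_eq)

text \<open>At a level where the hole period is \<open>p n\<close>, divisibility forces the residue
  of \<open>F\<close> to be that of the k-th power of the shift. Infinitely many such levels
  identify the two automorphisms.\<close>

lemma carrier_Aut_eq_powers:
  assumes shifts: "\<And>F. F \<in> carrier (Aut \<eta>) \<Longrightarrow> \<exists>k. boundary_shift \<eta> p \<pi> F k"
    and inf: "infinite {n. hole_period \<eta> p n = p n}"
  shows "carrier (Aut \<eta>) = range (\<lambda>k::int. shift_aut \<eta> [^]\<^bsub>Aut \<eta>\<^esub> k)"
proof (intro equalityI subsetI)
  fix F assume F: "F \<in> carrier (Aut \<eta>)"
  obtain k where k: "boundary_shift \<eta> p \<pi> F k"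
    using shifts[OF F] by blast
  have pow: "shift_aut \<eta> [^]\<^bsub>Aut \<eta>\<^esub> k \<in> carrier (Aut \<eta>)"
    by (simp add: shift_aut_in_Aut)
  have "T n F = T n (shift_aut \<eta> [^]\<^bsub>Aut \<eta>\<^esub> k)" if n: "hole_period \<eta> p n = p n" for n
  proof -
    have "[T n F = k] (mod int (p n))"
      using hole_period_dvd_translation[OF F k, of n] n by (simp add: cong_iff_dvd_diff)
    then show ?thesis
      using G_mod_self[OF translation_in_G[OF F], of n]
      by (simp add: Aut.T_int_pow shift_aut_in_Aut translation_shift_aut cong_def mod_mult_right_eq)
  qed
  then have "infinite {n. T n F = T n (shift_aut \<eta> [^]\<^bsub>Aut \<eta>\<^esub> k)}"
    using inf by (elim infinite_super[rotated]) auto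
  then have "F = shift_aut \<eta> [^]\<^bsub>Aut \<eta>\<^esub> k"
    by (rule Aut.eq_if_frequently_T_eq[OF F pow])
  then show "F \<in> range (\<lambda>k::int. shift_aut \<eta> [^]\<^bsub>Aut \<eta>\<^esub> k)"
    by blast
qed (auto simp: shift_aut_in_Aut)

lemma Aut_splits:
  assumes shifts: "\<And>F. F \<in> carrier (Aut \<eta>) \<Longrightarrow> \<exists>!k. boundary_shift \<eta> p \<pi> F k"
    and lim: "liminf (\<lambda>n. enat (p n div hole_period \<eta> p n)) = enat M"
  shows "internal_direct_sum (Aut \<eta>) (generate (Aut \<eta>) {shift_aut \<eta>}) (torsion (Aut \<eta>))"
    and "cyclic_group ((Aut \<eta>)\<lparr>carrier := torsion (Aut \<eta>)\<rparr>)"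
    and "finite (torsion (Aut \<eta>))"
    and "order ((Aut \<eta>)\<lparr>carrier := torsion (Aut \<eta>)\<rparr>) dvd M"
proof -
  define \<kappa> where "\<kappa> F = (THE k. boundary_shift \<eta> p \<pi> F k)" for F
  have \<kappa>: "boundary_shift \<eta> p \<pi> F (\<kappa> F)" if "F \<in> carrier (Aut \<eta>)" for F
    unfolding \<kappa>_def by (rule theI'[OF shifts[OF that]])
  have \<kappa>_eq: "\<kappa> F = k" if "F \<in> carrier (Aut \<eta>)" "boundary_shift \<eta> p \<pi> F k" for F k
    using shifts[OF that(1)] \<kappa>[OF that(1)] that(2) by blast
  have hom: "\<kappa> \<in> hom (Aut \<eta>) integer_group"
    by (rule homI) (auto intro!: \<kappa>_eq boundary_shift_mult \<kappa>)
  have s: "\<kappa> (shift_aut \<eta>) = 1"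
    by (intro \<kappa>_eq shift_aut_in_Aut boundary_shift_shift_aut)
  have dvd: "int (hole_period \<eta> p n) dvd T n F" if "F \<in> carrier (Aut \<eta>)" "\<kappa> F = 0" for n F
    using hole_period_dvd_translation[OF that(1) \<kappa>[OF that(1)], of n] that(2) by simp
  \<comment> \<open>The hole period divides \<open>p n\<close>, so the quotient is exact and
    multiplying back loses nothing.\<close>
  have "{n. p n div hole_period \<eta> p n = M} \<subseteq> {n. p n = M * hole_period \<eta> p n}"
    using hole_period_dvd_period by auto
  then have inf: "infinite {n. p n = M * hole_period \<eta> p n}"
    using liminf_enat_eq_imp_infinite[OF lim] infinite_super by blast
  show "internal_direct_sum (Aut \<eta>) (generate (Aut \<eta>) {shift_aut \<eta>}) (torsion (Aut \<eta>))"
    by (rule Aut.internal_direct_sum_torsion[where \<tau> = "hole_period \<eta> p" and \<kappa> = \<kappa> and M = M])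
      (fact hom shift_aut_in_Aut s inf | erule (1) dvd)+
  show "cyclic_group ((Aut \<eta>)\<lparr>carrier := torsion (Aut \<eta>)\<rparr>)" "finite (torsion (Aut \<eta>))"
    "order ((Aut \<eta>)\<lparr>carrier := torsion (Aut \<eta>)\<rparr>) dvd M"
    by (rule Aut.torsion_cyclic[where \<tau> = "hole_period \<eta> p" and \<kappa> = \<kappa> and s = "shift_aut \<eta>"
          and M = M]; (fact hom shift_aut_in_Aut s inf | erule (1) dvd))+
qed

end

theorem theorem2p8:
  fixes \<eta> :: "int \<Rightarrow> bool" and p :: "nat \<Rightarrow> nat" and \<pi> :: "(int \<Rightarrow> bool) \<Rightarrow> nat \<Rightarrow> int"
  assumes "nonperiodic_toeplitz \<eta> p"
    and "odometer_factor_map \<eta> p \<pi>"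
  shows
    "(\<forall>F \<in> carrier (Aut \<eta>). \<forall>k. boundary_shift \<eta> p \<pi> F k \<longrightarrow>
        (\<forall>n. dvd_mod (p n) (hole_period \<eta> p n) (translation \<eta> p \<pi> F n - k)))
     \<and>
     ((\<forall>F \<in> carrier (Aut \<eta>). \<exists>k. boundary_shift \<eta> p \<pi> F k) \<and>
        infinite {n. hole_period \<eta> p n = p n} \<longrightarrow>
        carrier (Aut \<eta>) = range (\<lambda>k::int. shift_aut \<eta> [^]\<^bsub>Aut \<eta>\<^esub> k))
     \<and>
     (\<forall>M::nat. (\<forall>F \<in> carrier (Aut \<eta>). \<exists>!k. boundary_shift \<eta> p \<pi> F k) \<and>
        liminf (\<lambda>n. enat (p n div hole_period \<eta> p n)) = enat M \<longrightarrow>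
        internal_direct_sum (Aut \<eta>) (generate (Aut \<eta>) {shift_aut \<eta>}) (torsion (Aut \<eta>)) \<and>
        cyclic_group ((Aut \<eta>)\<lparr>carrier := torsion (Aut \<eta>)\<rparr>) \<and>
        finite (torsion (Aut \<eta>)) \<and>
        order ((Aut \<eta>)\<lparr>carrier := torsion (Aut \<eta>)\<rparr>) dvd M)"
proof -
  interpret toeplitz_factor \<eta> p \<pi>
    using assms by unfold_locales
  \<comment> \<open>Divisibility already holds among the integers, so the congruence modulo
    \<open>p n\<close> is an equality.\<close>
  have "dvd_mod (p n) (hole_period \<eta> p n) (T n F - k)"
    if "F \<in> carrier (Aut \<eta>)" "boundary_shift \<eta> p \<pi> F k" for F k n
    using hole_period_dvd_translation[OF that, of n] unfolding dvd_mod_def by (metis cong_refl dvdE)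
  then show ?thesis
    using carrier_Aut_eq_powers Aut_splits by auto
qed

end
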